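(* Let $n$ be a nonnegative integer. For all nonnegative integers $a_0,a_1,\ldots,a_n$, $$\operatorname{CT}_x \prod_{0\le i\ne j\le n}\left(1-\frac{x_i}{x_j}\right)^{a_j}=\frac{(a_0+a_1+\cdots+a_n)!}{a_0!\,a_1!\cdots a_n!}.$$
   Context: $\operatorname{CT}_x$ denotes the constant term (the coefficient of $x_0^0x_1^0\cdots x_n^0$) of a Laurent polynomial in the variables $x_0,\ldots,x_n$. The product is over all ordered pairs $(i,j)$ with $0\le i,j\le n$ and $i\neq j$. *)

theory Defs
  imports Complex_Main "HOL-Library.Poly_Mapping"
begin

text \<open>
  Laurent polynomials in the variables \<open>x\<^sub>0, x\<^sub>1, \<dots>\<close> over \<open>'a\<close>, as the group algebra of the finitely
  supported integer exponent vectors; any given Laurent polynomial involves only finitely many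
  variables. Multiplication is the convolution product of \<open>Poly_Mapping\<close>.
\<close>

type_synonym 'a laurent = "(nat \<Rightarrow>\<^sub>0 int) \<Rightarrow>\<^sub>0 'a"

definition lvar :: "nat \<Rightarrow> 'a::comm_ring_1 laurent"
  where "lvar i = Poly_Mapping.single (Poly_Mapping.single i 1) 1"

definition lvar_inv :: "nat \<Rightarrow> 'a::comm_ring_1 laurent"
  where "lvar_inv i = Poly_Mapping.single (Poly_Mapping.single i (- 1)) 1"

lemma lvar_mult_lvar_inv: "lvar i * lvar_inv i = 1"
  by (simp add: lvar_def lvar_inv_def mult_single flip: single_add)

definition const_term :: "'a::comm_ring_1 laurent \<Rightarrow> 'a"
  where "const_term p = Poly_Mapping.lookup p 0"

end

theory Submission
  imports Defs "HOL-Computational_Algebra.Polynomial"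
begin

text \<open>
  This is Good's proof of Dyson's constant term identity. Write
  \<open>P\<^sub>j = \<Prod>i\<noteq>j. (1 - x\<^sub>i / x\<^sub>j)\<close>, so that the product in question is \<open>\<Prod>j. P\<^sub>j ^ a\<^sub>j\<close>. Lagrange
  interpolation of the constant polynomial \<open>1\<close> at the nodes \<open>1 / x\<^sub>j\<close>, evaluated at \<open>0\<close>, gives
  \<open>\<Sum>j. 1 / P\<^sub>j = 1\<close>. Hence, as long as every \<open>a\<^sub>j\<close> is positive, the product for \<open>a\<close> is the sum over
  \<open>j\<close> of the products in which \<open>a\<^sub>j\<close> is lowered by one (\<open>dyson_prod_recurrence\<close>). If some \<open>a\<^sub>k\<close>
  is zero, then \<open>x\<^sub>k\<close> occurs in numerators only, so that setting \<open>x\<^sub>k = 0\<close> does not change the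
  constant term and the index \<open>k\<close> can be dropped (\<open>const_term_dyson_prod_remove\<close>). The
  multinomial coefficients obey the same two rules and have the same value \<open>1\<close> on the empty index
  set, so an induction on the number of indices plus the sum of the exponents proves the identity.
  Since indices get dropped along the way, the induction runs over arbitrary finite index sets.
\<close>

section \<open>The interpolation identity\<close>

text \<open>
  The identity \<open>\<Sum>j. 1 / P\<^sub>j = 1\<close> with denominators cleared, so that it makes sense in the
  integral domain of Laurent polynomials. The interpolation polynomial, multiplied by \<open>\<Prod>k. P\<^sub>k\<close>, is
  \<open>\<Sum>j. (\<Prod>i\<noteq>j. (1 - x\<^sub>i X)) * (\<Prod>k\<noteq>j. P\<^sub>k)\<close>. It has degree less than \<open>card S\<close> and takes the
  value \<open>\<Prod>k. P\<^sub>k\<close> at each of the \<open>card S\<close> nodes \<open>y\<^sub>m\<close>, so it is constant; its value at \<open>0\<close> is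
  the right-hand side.
\<close>

lemma prod_eq_sum_prod_omit_one:
  fixes x y :: "'i \<Rightarrow> 'a::idom"
  assumes fin: "finite S" and ne: "S \<noteq> {}" and inj: "inj_on y S"
    and inverse: "\<And>j. j \<in> S \<Longrightarrow> x j * y j = 1"
  defines "P \<equiv> \<lambda>j. \<Prod>i\<in>S - {j}. 1 - x i * y j"
  shows "(\<Prod>k\<in>S. P k) = (\<Sum>j\<in>S. \<Prod>k\<in>S - {j}. P k)"
proof -
  define L where "L = (\<lambda>j. \<Prod>i\<in>S - {j}. [:1, - x i:])"
  define f where "f = (\<Sum>j\<in>S. smult (\<Prod>k\<in>S - {j}. P k) (L j))"
  have L_node: "poly (L j) (y m) = (if j = m then P m else 0)" if "m \<in> S" for j m
    using that fin inverse[OF that]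
    by (auto simp: L_def P_def poly_prod algebra_simps intro!: prod.cong bexI[of _ m])
  have L_0: "poly (L j) 0 = 1" for j
    by (simp add: L_def poly_prod)
  have "degree (L j) \<le> card S - 1" if "j \<in> S" for j
  proof -
    have "degree (L j) \<le> (\<Sum>i\<in>S - {j}. degree [:1, - x i:])"
      unfolding L_def using degree_prod_sum_le[of "S - {j}" "\<lambda>i. [:1, - x i:]"] fin
      by (simp add: o_def)
    also have "\<dots> \<le> (\<Sum>i\<in>S - {j}. 1)"
      by (intro sum_mono) simp
    finally show ?thesis
      using that fin by simp
  qed
  then have "degree f \<le> card S - 1"
    unfolding f_def using fin by (intro degree_sum_le) (auto intro: order.trans[OF degree_smult_le])
  moreover have "card (y ` S) = card S"
    using inj by (rule card_image)
  moreover have "card S > 0"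
    using fin ne by (simp add: card_gt_0_iff)
  moreover have "poly f (y m) = (\<Prod>k\<in>S. P k)" if "m \<in> S" for m
  proof -
    have "poly f (y m) = (\<Sum>j\<in>S. if j = m then (\<Prod>k\<in>S - {m}. P k) * P m else 0)"
      unfolding f_def poly_sum using that by (intro sum.cong) (auto simp: L_node)
    also have "\<dots> = P m * (\<Prod>k\<in>S - {m}. P k)"
      using that fin by simp
    also have "\<dots> = (\<Prod>k\<in>S. P k)"
      using that fin by (simp add: prod.remove)
    finally show ?thesis .
  qed
  ultimately have "f = [:\<Prod>k\<in>S. P k:]"
    by (intro poly_eqI_degree[of "y ` S"]) auto
  then have "(\<Prod>k\<in>S. P k) = poly f 0"
    by simp
  also have "\<dots> = (\<Sum>j\<in>S. \<Prod>k\<in>S - {j}. P k)"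
    by (simp add: f_def poly_sum L_0)
  finally show ?thesis .
qed

section \<open>The Dyson product and its recurrence\<close>

definition dyson_prod :: "nat set \<Rightarrow> (nat \<Rightarrow> nat) \<Rightarrow> 'a::comm_ring_1 laurent"
  where "dyson_prod S a = (\<Prod>j\<in>S. (\<Prod>i\<in>S - {j}. 1 - lvar i * lvar_inv j) ^ a j)"

lemma inj_lvar_inv: "inj (lvar_inv :: nat \<Rightarrow> 'a::comm_ring_1 laurent)"
proof (rule injI)
  fix i j :: nat
  assume "lvar_inv i = (lvar_inv j :: 'a laurent)"
  then have "Poly_Mapping.keys (lvar_inv i :: 'a laurent)
      = Poly_Mapping.keys (lvar_inv j :: 'a laurent)"
    by simp
  then have "Poly_Mapping.single i (- 1 :: int) = Poly_Mapping.single j (- 1)"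
    by (simp add: lvar_inv_def)
  then have "Poly_Mapping.keys (Poly_Mapping.single i (- 1 :: int))
      = Poly_Mapping.keys (Poly_Mapping.single j (- 1 :: int))"
    by simp
  then show "i = j"
    by simp
qed

lemma dyson_prod_recurrence:
  fixes a :: "nat \<Rightarrow> nat"
  assumes fin: "finite S" and "S \<noteq> {}" and pos: "\<And>j. j \<in> S \<Longrightarrow> a j > 0"
  shows "(dyson_prod S a :: 'a::idom laurent) = (\<Sum>j\<in>S. dyson_prod S (a(j := a j - 1)))"
proof -
  define P :: "nat \<Rightarrow> 'a laurent"
    where "P = (\<lambda>j. \<Prod>i\<in>S - {j}. 1 - lvar i * lvar_inv j)"
  define Q where "Q = (\<Prod>k\<in>S. P k ^ (a k - 1))"
  have dyson_prod_P: "dyson_prod S b = (\<Prod>k\<in>S. P k ^ b k)" for b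
    by (simp add: dyson_prod_def P_def)
  have "dyson_prod S a = Q * (\<Prod>k\<in>S. P k)"
    unfolding dyson_prod_P Q_def prod.distrib[symmetric]
    using pos by (intro prod.cong) (auto simp flip: power_Suc2)
  also have "(\<Prod>k\<in>S. P k) = (\<Sum>j\<in>S. \<Prod>k\<in>S - {j}. P k)"
    unfolding P_def using fin \<open>S \<noteq> {}\<close>
    by (intro prod_eq_sum_prod_omit_one)
      (auto simp: lvar_mult_lvar_inv intro: inj_on_subset[OF inj_lvar_inv])
  also have "Q * \<dots> = (\<Sum>j\<in>S. Q * (\<Prod>k\<in>S - {j}. P k))"
    by (rule sum_distrib_left)
  also have "\<dots> = (\<Sum>j\<in>S. dyson_prod S (a(j := a j - 1)))"
  proof (rule sum.cong)
    fix j assume "j \<in> S"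
    have "dyson_prod S (a(j := a j - 1)) = P j ^ (a j - 1) * (\<Prod>k\<in>S - {j}. P k ^ a k)"
      unfolding dyson_prod_P using fin \<open>j \<in> S\<close> by (subst prod.remove) auto
    also have "(\<Prod>k\<in>S - {j}. P k ^ a k) = (\<Prod>k\<in>S - {j}. P k ^ (a k - 1) * P k)"
      using pos by (intro prod.cong) (auto simp flip: power_Suc2)
    also have "P j ^ (a j - 1) * \<dots> = Q * (\<Prod>k\<in>S - {j}. P k)"
      unfolding Q_def using fin \<open>j \<in> S\<close> by (simp add: prod.distrib prod.remove mult.assoc)
    finally show "Q * (\<Prod>k\<in>S - {j}. P k) = dyson_prod S (a(j := a j - 1))" ..
  qed simp
  finally show ?thesis .
qed

section \<open>Dropping an index with exponent zero\<close>

text \<open>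
  The \<open>x\<^sub>k\<close>-adic order, stated as a lower bound in order not to need a value for the zero
  polynomial, whose order is infinite.
\<close>

definition order_ge :: "nat \<Rightarrow> int \<Rightarrow> 'a::comm_ring_1 laurent \<Rightarrow> bool"
  where "order_ge k m p \<longleftrightarrow> (\<forall>e\<in>Poly_Mapping.keys p. m \<le> Poly_Mapping.lookup e k)"

lemma order_ge_mono: "order_ge k m p \<Longrightarrow> m' \<le> m \<Longrightarrow> order_ge k m' p"
  by (auto simp: order_ge_def)

lemma order_ge_add: "order_ge k m p \<Longrightarrow> order_ge k m q \<Longrightarrow> order_ge k m (p + q)"
  using keys_add[of p q] by (auto simp: order_ge_def)

lemma order_ge_uminus: "order_ge k m p \<Longrightarrow> order_ge k m (- p)"
  by (simp add: order_ge_def in_keys_iff)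

lemma order_ge_diff: "order_ge k m p \<Longrightarrow> order_ge k m q \<Longrightarrow> order_ge k m (p - q)"
  using order_ge_add[of k m p "- q"] by (simp add: order_ge_uminus)

lemma order_ge_mult: "order_ge k m p \<Longrightarrow> order_ge k m' q \<Longrightarrow> order_ge k (m + m') (p * q)"
  using keys_mult[of p q] by (fastforce simp: order_ge_def lookup_add)

lemma order_ge_1: "order_ge k 0 1"
  by (simp add: order_ge_def)

lemma order_ge_power: "order_ge k 0 p \<Longrightarrow> order_ge k 0 (p ^ r)"
  by (induction r) (use order_ge_mult[of k 0 _ 0] in \<open>auto simp: order_ge_1\<close>)

lemma order_ge_prod: "(\<And>i. i \<in> A \<Longrightarrow> order_ge k 0 (f i)) \<Longrightarrow> order_ge k 0 (\<Prod>i\<in>A. f i)"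
  by (induction A rule: infinite_finite_induct)
    (use order_ge_mult[of k 0 _ 0] in \<open>auto simp: order_ge_1\<close>)

lemma order_ge_lvar_mult_lvar_inv:
  assumes "k \<noteq> j"
  shows "order_ge k (if i = k then 1 else 0) (lvar i * lvar_inv j)"
  using assms
  by (auto simp: order_ge_def lvar_def lvar_inv_def mult_single lookup_add lookup_single)

lemma const_term_eq_0: "order_ge k 1 p \<Longrightarrow> const_term p = 0"
  by (force simp: order_ge_def const_term_def in_keys_iff)

text \<open>
  If \<open>p - 1\<close> has only terms with a positive exponent of \<open>x\<^sub>k\<close>, then \<open>p\<close> turns into \<open>1\<close> under
  \<open>x\<^sub>k = 0\<close>. Such \<open>p\<close> are closed under multiplication, because
  \<open>p q - 1 = (p - 1) (q - 1) + (p - 1) + (q - 1)\<close>.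
\<close>

lemma order_ge_mult_minus_1:
  assumes "order_ge k 1 (p - 1)" and "order_ge k 1 (q - 1)"
  shows "order_ge k 1 (p * q - 1)"
proof -
  have "p * q - 1 = (p - 1) * (q - 1) + (p - 1) + (q - 1)"
    by (simp add: algebra_simps)
  moreover have "order_ge k 1 ((p - 1) * (q - 1))"
    using order_ge_mult[OF assms] by (rule order_ge_mono) simp
  ultimately show ?thesis
    using assms by (simp only: order_ge_add)
qed

lemma order_ge_power_minus_1: "order_ge k 1 (p - 1) \<Longrightarrow> order_ge k 1 (p ^ r - 1)"
  by (induction r) (auto simp: order_ge_mult_minus_1 order_ge_def[of _ _ 0])

lemma order_ge_prod_minus_1:
  "(\<And>i. i \<in> A \<Longrightarrow> order_ge k 1 (f i - 1)) \<Longrightarrow> order_ge k 1 ((\<Prod>i\<in>A. f i) - 1)"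
  by (induction A rule: infinite_finite_induct)
    (auto simp: order_ge_mult_minus_1 order_ge_def[of _ _ 0])

text \<open>
  Because of \<open>a\<^sub>k = 0\<close>, the factors \<open>(1 - x\<^sub>i / x\<^sub>k) ^ a\<^sub>k\<close> with \<open>x\<^sub>k\<close> in the denominator are
  trivial. The other factors involving \<open>x\<^sub>k\<close> turn into \<open>1\<close> under \<open>x\<^sub>k = 0\<close>; their product \<open>B\<close>
  multiplies the Dyson product \<open>D\<close> for the smaller index set, which is free of \<open>x\<^sub>k\<close>. So every
  term of \<open>(B - 1) * D\<close> has a positive exponent of \<open>x\<^sub>k\<close> and the constant term comes from \<open>D\<close>.
\<close>

lemma const_term_dyson_prod_remove:
  assumes fin: "finite S" and k: "k \<in> S" and "a k = 0"
  shows "const_term (dyson_prod S a :: 'a::comm_ring_1 laurent)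
    = const_term (dyson_prod (S - {k}) a)"
proof -
  define T where "T = S - {k}"
  have T: "finite T" "k \<notin> T" "S = insert k T"
    using fin k by (auto simp: T_def)
  define D :: "'a laurent" where "D = dyson_prod T a"
  define B :: "'a laurent" where "B = (\<Prod>j\<in>T. (1 - lvar k * lvar_inv j) ^ a j)"
  have "dyson_prod S a
      = (\<Prod>j\<in>T. ((1 - lvar k * lvar_inv j) * (\<Prod>i\<in>T - {j}. 1 - lvar i * lvar_inv j)) ^ a j
        :: 'a laurent)"
  proof -
    have "(\<Prod>i\<in>S - {j}. 1 - lvar i * lvar_inv j)
        = (1 - lvar k * lvar_inv j) * (\<Prod>i\<in>T - {j}. 1 - lvar i * lvar_inv j :: 'a laurent)"
      if "j \<in> T" for j
    proof -
      have "S - {j} = insert k (T - {j})"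
        using that T by auto
      then show ?thesis
        using T by simp
    qed
    then show ?thesis
      unfolding dyson_prod_def T(3) using T(1,2) \<open>a k = 0\<close> by (auto simp: T(3) intro!: prod.cong)
  qed
  also have "\<dots> = B * D"
    by (simp add: B_def D_def dyson_prod_def power_mult_distrib prod.distrib)
  also have "\<dots> = D + (B - 1) * D"
    by (simp add: algebra_simps)
  finally have "const_term (dyson_prod S a) = const_term D + const_term ((B - 1) * D)"
    by (simp add: const_term_def lookup_add)
  moreover have "order_ge k 0 D"
    unfolding D_def dyson_prod_def using T(2)
    by (intro order_ge_prod order_ge_power order_ge_diff order_ge_1
        order_ge_mono[OF order_ge_lvar_mult_lvar_inv]) auto
  moreover have "order_ge k 1 (B - 1)"
    unfolding B_def
  proof (intro order_ge_prod_minus_1 order_ge_power_minus_1)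
    fix j assume "j \<in> T"
    then have "order_ge k 1 (lvar k * lvar_inv j :: 'a laurent)"
      using order_ge_lvar_mult_lvar_inv[of k j k] T(2) by auto
    then show "order_ge k 1 (1 - lvar k * lvar_inv j - 1 :: 'a laurent)"
      by (simp add: order_ge_uminus)
  qed
  ultimately show ?thesis
    using order_ge_mult[of k 1 "B - 1" 0 D] by (simp add: const_term_eq_0 D_def T_def)
qed

section \<open>The constant term\<close>

text \<open>
  Pascal's rule for multinomial coefficients: with \<open>N\<close> the sum of the \<open>a\<^sub>j\<close>, the summand for \<open>j\<close>
  is \<open>a\<^sub>j / N\<close> times the right-hand side.
\<close>

lemma multinomial_recurrence:
  fixes a :: "'i \<Rightarrow> nat"
  assumes fin: "finite S" and "S \<noteq> {}" and pos: "\<And>j. j \<in> S \<Longrightarrow> a j > 0"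
  shows "(\<Sum>j\<in>S. fact (\<Sum>i\<in>S. (a(j := a j - 1)) i) / (\<Prod>i\<in>S. fact ((a(j := a j - 1)) i)))
    = (fact (\<Sum>i\<in>S. a i) / (\<Prod>i\<in>S. fact (a i)) :: 'k::field_char_0)"
proof -
  define N where "N = (\<Sum>i\<in>S. a i)"
  define F :: 'k where "F = (\<Prod>i\<in>S. fact (a i))"
  have "N > 0"
    using assms by (auto simp: N_def intro: sum_pos)
  have "fact (\<Sum>i\<in>S. (a(j := a j - 1)) i) / (\<Prod>i\<in>S. fact ((a(j := a j - 1)) i))
      = of_nat (a j) * (fact (N - 1) / F)" if "j \<in> S" for j
  proof -
    have rest: "(\<Sum>i\<in>S - {j}. (a(j := a j - 1)) i) = (\<Sum>i\<in>S - {j}. a i)"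
      "(\<Prod>i\<in>S - {j}. fact ((a(j := a j - 1)) i)) = (\<Prod>i\<in>S - {j}. fact (a i) :: 'k)"
      by (auto intro: sum.cong prod.cong)
    have "(\<Sum>i\<in>S. (a(j := a j - 1)) i) = N - 1"
      unfolding N_def sum.remove[OF fin that] rest using pos[OF that] by simp
    moreover have "F = of_nat (a j) * (\<Prod>i\<in>S. fact ((a(j := a j - 1)) i))"
      unfolding F_def prod.remove[OF fin that] rest
      using pos[OF that] by (simp add: fact_reduce)
    ultimately show ?thesis
      using pos[OF that] by simp
  qed
  then have "(\<Sum>j\<in>S. fact (\<Sum>i\<in>S. (a(j := a j - 1)) i) / (\<Prod>i\<in>S. fact ((a(j := a j - 1)) i)))
      = of_nat N * (fact (N - 1) / F)"
    unfolding N_def of_nat_sum sum_distrib_right by (intro sum.cong) (simp_all only:)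
  also have "\<dots> = fact N / F"
    using \<open>N > 0\<close> by (simp add: fact_reduce)
  finally show ?thesis
    by (simp add: N_def F_def)
qed

lemma const_term_dyson_prod:
  assumes "finite S"
  shows "const_term (dyson_prod S a)
    = (fact (\<Sum>i\<in>S. a i) / (\<Prod>i\<in>S. fact (a i)) :: 'k::field_char_0)"
  using assms
proof (induction "card S + sum a S" arbitrary: S a rule: less_induct)
  case less
  note fin = \<open>finite S\<close>
  consider "S = {}" | k where "k \<in> S" "a k = 0" | "S \<noteq> {}" "\<And>j. j \<in> S \<Longrightarrow> a j > 0"
    by blast
  then show ?case
  proof cases
    case 1
    then show ?thesis
      by (simp add: dyson_prod_def const_term_def)
  next
    case 2
    have "card (S - {k}) + sum a (S - {k}) < card S + sum a S"
      using fin 2 card_Diff1_less[OF fin \<open>k \<in> S\<close>] by (simp add: sum.remove del: card_Diff_singleton)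
    then show ?thesis
      using less.hyps[of "S - {k}" a] fin 2
      by (simp add: const_term_dyson_prod_remove sum.remove prod.remove)
  next
    case 3
    have "const_term (dyson_prod S (a(j := a j - 1)))
        = (fact (\<Sum>i\<in>S. (a(j := a j - 1)) i) / (\<Prod>i\<in>S. fact ((a(j := a j - 1)) i)) :: 'k)"
      if "j \<in> S" for j
    proof (rule less.hyps)
      have "sum (a(j := a j - 1)) S < sum a S"
        using fin that 3 by (intro sum_strict_mono_ex1) auto
      then show "card S + sum (a(j := a j - 1)) S < card S + sum a S"
        by simp
    qed (rule fin)
    moreover have "const_term (dyson_prod S a :: 'k laurent)
        = (\<Sum>j\<in>S. const_term (dyson_prod S (a(j := a j - 1))))"
      using dyson_prod_recurrence[OF fin 3, where 'a = 'k] by (simp add: const_term_def lookup_sum)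
    ultimately show ?thesis
      using multinomial_recurrence[OF fin 3, where 'k = 'k] by (simp del: fun_upd_apply)
  qed
qed

theorem theorem1p1:
  fixes n :: nat and a :: "nat \<Rightarrow> nat"
  shows "const_term (\<Prod>(i, j) \<in> {(i, j). i \<le> n \<and> j \<le> n \<and> i \<noteq> j}.
            (1 - lvar i * lvar_inv j) ^ a j)
       = (fact (\<Sum>i\<le>n. a i) / (\<Prod>i\<le>n. fact (a i)) :: 'k::field_char_0)"
proof -
  have "(\<Prod>(i, j) \<in> {(i, j). i \<le> n \<and> j \<le> n \<and> i \<noteq> j}. (1 - lvar i * lvar_inv j) ^ a j)
      = (\<Prod>(j, i) \<in> (SIGMA j:{..n}. {..n} - {j}). (1 - lvar i * lvar_inv j) ^ a j :: 'k laurent)"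
    by (rule prod.reindex_bij_witness[of _ prod.swap prod.swap]) auto
  also have "\<dots> = dyson_prod {..n} a"
    by (simp add: dyson_prod_def prod_power_distrib prod.Sigma)
  finally show ?thesis
    by (simp add: const_term_dyson_prod)
qed

end
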